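(* Let $n\in\{1,2,\dots\}$ or $n=\infty$. Let $T:=[T_1,\dots,T_n]$, $T_i\in B(\mathcal H)$, be a row contraction and let $V:=[V_1,\dots,V_n]$, $V_i\in B(\mathcal K)$, be an isometric lifting of $T$ on a Hilbert space $\mathcal K\supseteq\mathcal H$. Let $\mathcal X$ and $\mathcal G_i$, $i=1,\dots,n$, be Hilbert spaces, let $Q_i\in B(\mathcal G_i,\mathcal X)$ be operators with (pairwise) orthogonal ranges, and let $C_i\in B(\mathcal G_i,\mathcal X)$ be such that $C_i^*C_i\le Q_i^*Q_i$ for every $i=1,\dots,n$. If $A\in B(\mathcal X,\mathcal H)$ is such that $$T_iAC_i=AQ_i\quad\text{for every } i=1,\dots,n,$$ then there is an operator $B\in B(\mathcal X,\mathcal K)$ such that $P_{\mathcal H}B=A$, $\|B\|=\|A\|$, and $$V_iBC_i=BQ_i\quad\text{for every } i=1,\dots,n.$$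
   Context: All spaces are complex Hilbert spaces; $B(\mathcal X,\mathcal H)$ denotes the bounded linear operators from $\mathcal X$ to $\mathcal H$ and $B(\mathcal H)=B(\mathcal H,\mathcal H)$. $P_{\mathcal H}$ is the orthogonal projection of $\mathcal K$ onto $\mathcal H$. A row contraction is a sequence $[T_1,\dots,T_n]$ with $T_i\in B(\mathcal H)$ and $T_1T_1^*+\cdots+T_nT_n^*\le I_{\mathcal H}$. An isometric lifting of $T$ on $\mathcal K\supseteq\mathcal H$ is a sequence $[V_1,\dots,V_n]$, $V_i\in B(\mathcal K)$, with $V_i^*V_j=\delta_{ij}I_{\mathcal K}$ and $P_{\mathcal H}V_i=T_iP_{\mathcal H}$ for all $i,j$. *)

theory Defs
  imports "HOL-Analysis.Analysis" "HOL-Library.Extended_Nat"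
begin

text \<open>
  A complex inner product space is a real inner product space together with a complex
  structure and a sesquilinear form whose real part is the given real inner product.
  Positive definiteness of \<open>cinner\<close> and
  \<open>norm x = sqrt (Re (cinner x x))\<close> are inherited from class \<open>real_inner\<close>;
  \<open>cinner\<close> is linear in its first argument.
\<close>

class complex_inner = real_inner +
  fixes scaleC :: "complex \<Rightarrow> 'a \<Rightarrow> 'a"  (infixr "*\<^sub>C" 75)
    and cinner :: "'a \<Rightarrow> 'a \<Rightarrow> complex"
  assumes scaleC_add_right: "a *\<^sub>C (x + y) = a *\<^sub>C x + a *\<^sub>C y"
    and scaleC_add_left: "(a + b) *\<^sub>C x = a *\<^sub>C x + b *\<^sub>C x"
    and scaleC_scaleC: "a *\<^sub>C (b *\<^sub>C x) = (a * b) *\<^sub>C x"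
    and scaleC_of_real: "complex_of_real r *\<^sub>C x = r *\<^sub>R x"
    and cinner_commute: "cinner x y = cnj (cinner y x)"
    and cinner_add_left: "cinner (x + y) z = cinner x z + cinner y z"
    and cinner_scaleC_left: "cinner (a *\<^sub>C x) y = a * cinner x y"
    and inner_eq_Re_cinner: "inner x y = Re (cinner x y)"

class chilbert_space = complex_inner + complete_space

instantiation complex :: chilbert_space
begin

definition scaleC_complex :: "complex \<Rightarrow> complex \<Rightarrow> complex"
  where "scaleC_complex a x = a * x"

definition cinner_complex :: "complex \<Rightarrow> complex \<Rightarrow> complex"
  where "cinner_complex x y = x * cnj y"

instance
  by standard
    (simp_all add: scaleC_complex_def cinner_complex_def algebra_simps inner_complex_def
      scaleR_conv_of_real)

end

text \<open>
  Hilbert spaces that sit inside another one, or that occur in a family, are represented by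
  closed complex subspaces of a Hilbert space type. For a family \<open>G\<^sub>i\<close> this is
  no restriction, since arbitrary Hilbert spaces \<open>G\<^sub>i\<close> embed isometrically into
  their Hilbert space direct sum. Operators between such subspaces are functions on the ambient
  types of which only the values on the domain subspace matter.
\<close>

definition closed_csubspace :: "'a::chilbert_space set \<Rightarrow> bool"
  where "closed_csubspace S \<longleftrightarrow>
    0 \<in> S \<and> (\<forall>x\<in>S. \<forall>y\<in>S. x + y \<in> S) \<and> (\<forall>a. \<forall>x\<in>S. a *\<^sub>C x \<in> S) \<and> closed S"

definition bounded_ops ::
    "'a::chilbert_space set \<Rightarrow> 'b::chilbert_space set \<Rightarrow> ('a \<Rightarrow> 'b) set"
  where "bounded_ops S R = {f.
    (\<forall>x\<in>S. f x \<in> R) \<and>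
    (\<forall>x\<in>S. \<forall>y\<in>S. f (x + y) = f x + f y) \<and>
    (\<forall>a. \<forall>x\<in>S. f (a *\<^sub>C x) = a *\<^sub>C f x) \<and>
    (\<exists>M. \<forall>x\<in>S. norm (f x) \<le> M * norm x)}"

text \<open>
  The Hilbert space adjoint in \<open>bounded_ops R S\<close> of an operator in
  \<open>bounded_ops S R\<close>; it is uniquely determined on \<open>R\<close>.
\<close>

definition adj_on ::
    "'a::chilbert_space set \<Rightarrow> 'b::chilbert_space set \<Rightarrow> ('a \<Rightarrow> 'b) \<Rightarrow> 'b \<Rightarrow> 'a"
  where "adj_on S R f = (SOME g. g \<in> bounded_ops R S \<and>
    (\<forall>x\<in>S. \<forall>y\<in>R. cinner (f x) y = cinner x (g y)))"

definition orth_proj :: "'a::chilbert_space set \<Rightarrow> 'a \<Rightarrow> 'a"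
  where "orth_proj S x = (THE y. y \<in> S \<and> (\<forall>z\<in>S. cinner (x - y) z = 0))"

definition op_le_on ::
    "'a::chilbert_space set \<Rightarrow> ('a \<Rightarrow> 'a) \<Rightarrow> ('a \<Rightarrow> 'a) \<Rightarrow> bool"
  where "op_le_on S f g \<longleftrightarrow> (\<forall>x\<in>S. cinner (g x - f x) x \<in> \<real>\<^sub>\<ge>\<^sub>0)"

definition index_set :: "enat \<Rightarrow> nat set"
  where "index_set n = {i. 1 \<le> i \<and> enat i \<le> n}"

text \<open>
  For \<open>n = \<infinity>\<close> the series \<open>\<Sum>i. T\<^sub>i T\<^sub>i\<^sup>*\<close> is taken in the
  strong operator topology. Its terms are positive operators, so convergence of the series in the
  usual order of summation is the same as unconditional convergence.
\<close>

definition row_contraction ::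
    "enat \<Rightarrow> 'a::chilbert_space set \<Rightarrow> (nat \<Rightarrow> 'a \<Rightarrow> 'a) \<Rightarrow> bool"
  where "row_contraction n H T \<longleftrightarrow>
    (\<forall>i\<in>index_set n. T i \<in> bounded_ops H H) \<and>
    (\<forall>x\<in>H. (\<lambda>i. T i (adj_on H H (T i) x)) summable_on index_set n) \<and>
    op_le_on H (\<lambda>x. \<Sum>\<^sub>\<infinity>i\<in>index_set n. T i (adj_on H H (T i) x)) (\<lambda>x. x)"

text \<open>The space \<open>K\<close> of the lifting is the whole type.\<close>

definition isometric_lifting ::
    "enat \<Rightarrow> 'k::chilbert_space set \<Rightarrow> (nat \<Rightarrow> 'k \<Rightarrow> 'k) \<Rightarrow> (nat \<Rightarrow> 'k \<Rightarrow> 'k) \<Rightarrow> bool"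
  where "isometric_lifting n H T V \<longleftrightarrow>
    (\<forall>i\<in>index_set n. V i \<in> bounded_ops UNIV UNIV) \<and>
    (\<forall>i\<in>index_set n. \<forall>j\<in>index_set n. \<forall>x.
      adj_on UNIV UNIV (V i) (V j x) = (if i = j then x else 0)) \<and>
    (\<forall>i\<in>index_set n. \<forall>x. orth_proj H (V i x) = T i (orth_proj H x))"

end

theory Submission
  imports Defs
begin

text \<open>
  Starting from \<open>A\<close>, operators \<open>B\<^sub>m\<close> are built with values in the closed span
  \<open>K\<^sub>m\<close> of the vectors \<open>V\<^sub>\<alpha> h\<close>, where \<open>h \<in> H\<close> and \<open>\<alpha>\<close> is a
  word of length at most \<open>m\<close>, such that \<open>B\<^sub>m\<close> is the compression of \<open>B\<^bsub>m+1\<^esub>\<close> to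
  \<open>K\<^sub>m\<close> and \<open>V\<^sub>i B\<^sub>m C\<^sub>i = B\<^bsub>m+1\<^esub> Q\<^sub>i\<close>. The last equation prescribes
  \<open>B\<^bsub>m+1\<^esub>\<close> on the span of the ranges of the \<open>Q\<^sub>i\<close>; there its norm is at most
  \<open>\<parallel>A\<parallel>\<close>, because the ranges of the \<open>V\<^sub>i\<close> and those of the \<open>Q\<^sub>i\<close> are orthogonal and
  \<open>C\<^sub>i\<^sup>*C\<^sub>i \<le> Q\<^sub>i\<^sup>*Q\<^sub>i\<close>. Extending \<open>B\<^bsub>m+1\<^esub>\<close> to the whole space with prescribed
  compression \<open>B\<^sub>m\<close> is the extension of an operator dominated by the defect form of
  \<open>B\<^sub>m\<close>. As the increments are orthogonal and the norms bounded, \<open>B\<^sub>m x\<close> converges for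
  every \<open>x\<close>, and the limit is the required operator.
\<close>

section \<open>Extension of maps dominated by a semidefinite form\<close>

lemma le_of_mult_self_le:
  fixes a b :: real
  assumes "a * a \<le> b * a" "0 \<le> a" "0 \<le> b"
  shows "a \<le> b"
  using assms by (cases "a = 0") (auto simp: mult_le_cancel_right)

text \<open>For \<open>c > 0\<close> the quadratic is evaluated at its minimum
  \<open>- b / c\<close>. The degenerate case \<open>c = 0\<close> is included because the forms
  below are only semidefinite: an affine function bounded below is constant.\<close>

lemma quadratic_nonneg_imp_discriminant:
  fixes a b c :: real
  assumes "0 \<le> c" and nonneg: "\<And>t. 0 \<le> a + 2 * b * t + c * t\<^sup>2"
  shows "b\<^sup>2 \<le> a * c"
proof (cases "c = 0")
  case True
  have "b = 0"
  proof (rule ccontr)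
    assume "b \<noteq> 0"
    then have "a + 2 * b * (- (a + 1) / (2 * b)) = - 1" by (simp add: field_simps)
    with nonneg[of "- (a + 1) / (2 * b)"] True show False by simp
  qed
  with True show ?thesis by simp
next
  case False
  with \<open>0 \<le> c\<close> have "0 < c" by simp
  have "a + 2 * b * (- b / c) + c * (- b / c)\<^sup>2 = a - b\<^sup>2 / c"
    using \<open>0 < c\<close> by (simp add: field_simps power2_eq_square)
  with nonneg[of "- b / c"] have "b\<^sup>2 / c \<le> a" by simp
  with \<open>0 < c\<close> show ?thesis by (simp add: field_simps)
qed

lemma scaleC_diff_right: "a *\<^sub>C (x - y) = a *\<^sub>C x - a *\<^sub>C (y::'a::complex_inner)"
  using scaleC_add_right[of a "x - y" y] by simp

lemma norm_scaleC: "norm (a *\<^sub>C (x::'a::complex_inner)) = cmod a * norm x"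
proof -
  have "cinner (a *\<^sub>C x) (a *\<^sub>C x) = (a * cnj a) * cinner x x"
    by (metis cinner_commute cinner_scaleC_left complex_cnj_mult mult.assoc)
  also have "\<dots> = complex_of_real ((cmod a)\<^sup>2) * cinner x x" by (simp only: complex_norm_square)
  finally have "inner (a *\<^sub>C x) (a *\<^sub>C x) = (cmod a)\<^sup>2 * inner x x"
    by (simp add: inner_eq_Re_cinner flip: of_real_power)
  then show ?thesis by (simp add: norm_eq_sqrt_inner real_sqrt_mult)
qed

lemma tendsto_scaleC:
  assumes "w \<longlonglongrightarrow> (y::'a::complex_inner)"
  shows "(\<lambda>k. a *\<^sub>C w k) \<longlonglongrightarrow> a *\<^sub>C y"
proof -
  have "(\<lambda>k. cmod a * norm (w k - y)) \<longlonglongrightarrow> 0"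
    using assms by (auto intro!: tendsto_eq_intros simp: LIM_zero_iff tendsto_norm_zero)
  then have "(\<lambda>k. norm (a *\<^sub>C w k - a *\<^sub>C y)) \<longlonglongrightarrow> 0"
    by (simp add: norm_scaleC flip: scaleC_diff_right)
  then show ?thesis using LIM_zero_iff tendsto_norm_zero_iff by blast
qed

text \<open>
  A bounded linear map on a subspace, dominated by a positive semidefinite form, given by its
  graph \<open>\<Gamma>\<close>; that \<open>\<Gamma>\<close> is single-valued follows from the domination.
\<close>

locale dominated_graph =
  fixes s :: "'x::complex_inner \<Rightarrow> 'x \<Rightarrow> real"
    and \<Gamma> :: "('x \<times> 'k::chilbert_space) set"
  assumes form_commute: "s x y = s y x"
    and form_add_left: "s (x + y) u = s x u + s y u"
    and form_scaleR_left: "s (r *\<^sub>R x) y = r * s x y"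
    and form_scaleC_left: "s (a *\<^sub>C x) y = s x (cnj a *\<^sub>C y)"
    and form_nonneg: "0 \<le> s x x"
    and graph_zero: "(0, 0) \<in> \<Gamma>"
    and graph_add: "(m, z) \<in> \<Gamma> \<Longrightarrow> (m', z') \<in> \<Gamma> \<Longrightarrow> (m + m', z + z') \<in> \<Gamma>"
    and graph_scaleC: "(m, z) \<in> \<Gamma> \<Longrightarrow> (a *\<^sub>C m, a *\<^sub>C z) \<in> \<Gamma>"
    and graph_dominated: "(m, z) \<in> \<Gamma> \<Longrightarrow> (norm z)\<^sup>2 \<le> s m m"
begin

section \<open>Calculus of the form and its seminorm\<close>

lemma graph_scaleR: "(m, z) \<in> \<Gamma> \<Longrightarrow> (r *\<^sub>R m, r *\<^sub>R z) \<in> \<Gamma>"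
  using graph_scaleC[of m z "complex_of_real r"] by (simp add: scaleC_of_real)

lemma graph_diff: "(m, z) \<in> \<Gamma> \<Longrightarrow> (m', z') \<in> \<Gamma> \<Longrightarrow> (m - m', z - z') \<in> \<Gamma>"
  using graph_add[of m z "- m'" "- z'"] graph_scaleR[of m' z' "-1"] by simp

lemma form_add_right: "s z (x + y) = s z x + s z y"
  by (simp add: form_commute[of z] form_add_left)

lemma form_scaleR_right: "s x (r *\<^sub>R y) = r * s x y"
  by (simp add: form_commute[of x] form_scaleR_left)

lemma form_diff_left: "s (x - y) z = s x z - s y z"
  using form_add_left[of "x - y" y z] by simp

lemma form_diff_right: "s z (x - y) = s z x - s z y"
  by (simp add: form_commute[of z] form_diff_left)

lemma form_zero_left [simp]: "s 0 y = 0"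
  using form_scaleR_left[of 0 0 y] by simp

definition seminorm :: "'x \<Rightarrow> real"
  where "seminorm x = sqrt (s x x)"

lemma seminorm_nonneg [simp]: "0 \<le> seminorm x"
  by (simp add: seminorm_def form_nonneg)

lemma seminorm_square: "(seminorm x)\<^sup>2 = s x x"
  by (simp add: seminorm_def form_nonneg)

lemma norm_le_seminorm: "(m, z) \<in> \<Gamma> \<Longrightarrow> norm z \<le> seminorm m"
  using graph_dominated real_le_rsqrt by (auto simp: seminorm_def)

lemma form_Cauchy_Schwarz: "\<bar>s x y\<bar> \<le> seminorm x * seminorm y"
proof -
  have "(s x y)\<^sup>2 \<le> s x x * s y y"
  proof (rule quadratic_nonneg_imp_discriminant[OF form_nonneg])
    fix t
    show "0 \<le> s x x + 2 * s x y * t + s y y * t\<^sup>2"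
      using form_nonneg[of "x + t *\<^sub>R y"] form_commute[of x y]
      by (simp add: form_add_left form_add_right form_scaleR_left form_scaleR_right
          algebra_simps power2_eq_square)
  qed
  then have "sqrt ((s x y)\<^sup>2) \<le> sqrt (s x x * s y y)" by (rule real_sqrt_le_mono)
  then show ?thesis by (simp add: seminorm_def real_sqrt_mult)
qed

lemma seminorm_scaleC: "seminorm (a *\<^sub>C x) = cmod a * seminorm x"
proof -
  have "s (a *\<^sub>C x) (a *\<^sub>C x) = s x (complex_of_real ((cmod a)\<^sup>2) *\<^sub>C x)"
    unfolding complex_norm_square by (simp add: form_scaleC_left scaleC_scaleC mult.commute)
  also have "\<dots> = (cmod a)\<^sup>2 * s x x" by (simp only: scaleC_of_real form_scaleR_right)
  finally show ?thesis by (simp add: seminorm_def real_sqrt_mult)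
qed

text \<open>
  \<open>approx x y\<close> says that \<open>y\<close> is the value at the projection of \<open>x\<close> onto
  the completed domain of the graph; the projection itself need not exist, only sequences which
  are asymptotically orthogonal to the domain.
\<close>

definition approx :: "'x \<Rightarrow> 'k \<Rightarrow> bool"
  where "approx x y \<longleftrightarrow> (\<exists>p w e. (\<forall>k::nat. (p k, w k) \<in> \<Gamma>) \<and> e \<longlonglongrightarrow> 0 \<and> w \<longlonglongrightarrow> y \<and>
    (\<forall>k m z. (m, z) \<in> \<Gamma> \<longrightarrow> \<bar>s (x - p k) m\<bar> \<le> e k * seminorm m))"

lemma approx_graph: "(m, z) \<in> \<Gamma> \<Longrightarrow> approx m z"
  unfolding approx_def
  by (rule exI[of _ "\<lambda>_. m"], rule exI[of _ "\<lambda>_. z"], rule exI[of _ "\<lambda>_. 0"]) simp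

lemma approx_add:
  assumes "approx x y" "approx x' y'"
  shows "approx (x + x') (y + y')"
proof -
  obtain p w e where 1: "\<And>k. (p k, w k) \<in> \<Gamma>" "e \<longlonglongrightarrow> 0" "w \<longlonglongrightarrow> y"
      "\<And>k m z. (m, z) \<in> \<Gamma> \<Longrightarrow> \<bar>s (x - p k) m\<bar> \<le> e k * seminorm m"
    using assms(1) unfolding approx_def by blast
  obtain p' w' e' where 2: "\<And>k. (p' k, w' k) \<in> \<Gamma>" "e' \<longlonglongrightarrow> 0" "w' \<longlonglongrightarrow> y'"
      "\<And>k m z. (m, z) \<in> \<Gamma> \<Longrightarrow> \<bar>s (x' - p' k) m\<bar> \<le> e' k * seminorm m"
    using assms(2) unfolding approx_def by blast
  show ?thesis unfolding approx_def
  proof (intro exI conjI allI impI)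
    show "(p k + p' k, w k + w' k) \<in> \<Gamma>" for k using 1 2 graph_add by blast
    show "(\<lambda>k. e k + e' k) \<longlonglongrightarrow> 0" using tendsto_add[OF 1(2) 2(2)] by simp
    show "(\<lambda>k. w k + w' k) \<longlonglongrightarrow> y + y'" by (intro tendsto_add 1 2)
    fix k m z assume m: "(m, z) \<in> \<Gamma>"
    have "\<bar>s (x - p k) m\<bar> + \<bar>s (x' - p' k) m\<bar> \<le> (e k + e' k) * seminorm m"
      using add_mono[OF 1(4)[OF m, of k] 2(4)[OF m, of k]] by (simp add: algebra_simps)
    moreover have "s (x + x' - (p k + p' k)) m = s (x - p k) m + s (x' - p' k) m"
      by (simp add: form_add_left form_diff_left)
    ultimately show "\<bar>s (x + x' - (p k + p' k)) m\<bar> \<le> (e k + e' k) * seminorm m" by linarith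
  qed
qed

lemma approx_scaleC:
  assumes "approx x y"
  shows "approx (a *\<^sub>C x) (a *\<^sub>C y)"
proof -
  obtain p w e where 1: "\<And>k. (p k, w k) \<in> \<Gamma>" "e \<longlonglongrightarrow> 0" "w \<longlonglongrightarrow> y"
      "\<And>k m z. (m, z) \<in> \<Gamma> \<Longrightarrow> \<bar>s (x - p k) m\<bar> \<le> e k * seminorm m"
    using assms(1) unfolding approx_def by blast
  show ?thesis unfolding approx_def
  proof (intro exI conjI allI impI)
    show "(a *\<^sub>C p k, a *\<^sub>C w k) \<in> \<Gamma>" for k using 1 graph_scaleC by blast
    show "(\<lambda>k. cmod a * e k) \<longlonglongrightarrow> 0" using tendsto_mult_right_zero[OF 1(2)] by simp
    show "(\<lambda>k. a *\<^sub>C w k) \<longlonglongrightarrow> a *\<^sub>C y" using 1(3) by (rule tendsto_scaleC)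
    fix k m z assume "(m, z) \<in> \<Gamma>"
    \<comment> \<open>The scalar moves over to the test vector: \<open>cnj a *\<^sub>C m\<close> is
      again in the domain, with seminorm \<open>cmod a * seminorm m\<close>.\<close>
    from 1(4)[OF graph_scaleC[OF this, of "cnj a"], of k]
    show "\<bar>s (a *\<^sub>C x - a *\<^sub>C p k) m\<bar> \<le> cmod a * e k * seminorm m"
      by (simp add: form_scaleC_left seminorm_scaleC algebra_simps flip: scaleC_diff_right)
  qed
qed

text \<open>Projections do not increase the seminorm: testing the asymptotic orthogonality of
  \<open>x - p k\<close> against \<open>p k\<close> itself bounds \<open>seminorm (p k)\<close> by
  that of \<open>x\<close> up to \<open>e k\<close>. The graph values inherit the bound by
  domination, and so does their limit.\<close>

lemma approx_norm_le:
  assumes "approx x y"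
  shows "norm y \<le> seminorm x"
proof -
  obtain p w e where 1: "\<And>k. (p k, w k) \<in> \<Gamma>" "e \<longlonglongrightarrow> 0" "w \<longlonglongrightarrow> y"
      "\<And>k m z. (m, z) \<in> \<Gamma> \<Longrightarrow> \<bar>s (x - p k) m\<bar> \<le> e k * seminorm m"
    using assms(1) unfolding approx_def by blast
  have "norm (w k) \<le> seminorm x + \<bar>e k\<bar>" for k
  proof -
    have "seminorm (p k) * seminorm (p k) = s x (p k) - s (x - p k) (p k)"
      using seminorm_square[of "p k"] by (simp add: form_diff_left power2_eq_square)
    also have "\<dots> \<le> seminorm x * seminorm (p k) + e k * seminorm (p k)"
      using form_Cauchy_Schwarz[of x "p k"] 1(4)[OF 1(1), of k k] by linarith
    also have "\<dots> \<le> (seminorm x + \<bar>e k\<bar>) * seminorm (p k)"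
      by (simp add: algebra_simps mult_right_mono)
    finally have "seminorm (p k) \<le> seminorm x + \<bar>e k\<bar>"
      by (rule le_of_mult_self_le) simp_all
    with norm_le_seminorm[OF 1(1)] show ?thesis by (rule order_trans)
  qed
  moreover have "(\<lambda>k. seminorm x + \<bar>e k\<bar>) \<longlonglongrightarrow> seminorm x + \<bar>0\<bar>"
    by (intro tendsto_intros 1)
  ultimately show ?thesis
    using LIMSEQ_le[OF tendsto_norm[OF 1(3)], of "\<lambda>k. seminorm x + \<bar>e k\<bar>"] by auto
qed

text \<open>By linearity \<open>y - y'\<close> is a value at 0, and the norm bound makes it
  vanish.\<close>

lemma approx_unique:
  assumes "approx x y" "approx x y'"
  shows "y = y'"
proof -
  have "approx (x + (-1) *\<^sub>C x) (y + (-1) *\<^sub>C y')"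
    using assms by (intro approx_add approx_scaleC)
  then have "approx 0 (y - y')"
    using scaleC_of_real[of "-1" x] scaleC_of_real[of "-1" y'] by simp
  from approx_norm_le[OF this] show ?thesis by (simp add: seminorm_def)
qed

lemma approx_in_closure: "approx x y \<Longrightarrow> y \<in> closure (snd ` \<Gamma>)"
  unfolding approx_def closure_sequential by (metis image_eqI snd_conv)

text \<open>The \<open>p k\<close> form a minimizing sequence for the seminorm distance from
  \<open>x\<close> to the domain. They may fail to converge, but they are Cauchy in the seminorm, so
  by domination their graph values are Cauchy in the complete target space.\<close>

lemma approx_exists: "\<exists>y. approx x y"
proof -
  define D where "D = (\<lambda>(m, z). s (x - m) (x - m)) ` \<Gamma>"
  define d where "d = Inf D"
  have bdd: "bdd_below D" unfolding D_def by (rule bdd_belowI[of _ 0]) (auto intro: form_nonneg)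
  have ne: "D \<noteq> {}" using graph_zero unfolding D_def by auto
  have lower: "d \<le> s (x - m) (x - m)" if "(m, z) \<in> \<Gamma>" for m z
    unfolding d_def using that by (intro cInf_lower bdd) (force simp: D_def)
  have "\<exists>m z. (m, z) \<in> \<Gamma> \<and> s (x - m) (x - m) < d + inverse (real (Suc k))" for k
    using cInf_lessD[OF ne, of "d + inverse (real (Suc k))"] unfolding d_def D_def by force
  then obtain p w where pw: "\<And>k. (p k, w k) \<in> \<Gamma>"
      "\<And>k. s (x - p k) (x - p k) < d + inverse (real (Suc k))"
    by metis
  \<comment> \<open>The square root appears because the discriminant estimate bounds the square of
    \<open>s (x - p k) m\<close> by the excess of the squared distance over its infimum.\<close>
  define e where "e k = sqrt (inverse (real (Suc k)))" for k
  have e0: "e \<longlonglongrightarrow> 0"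
    unfolding e_def using tendsto_real_sqrt[OF LIMSEQ_inverse_real_of_nat] by simp
  have asym: "\<bar>s (x - p k) m\<bar> \<le> e k * seminorm m" if m: "(m, z) \<in> \<Gamma>" for k m z
  proof -
    have "(s (x - p k) m)\<^sup>2 \<le> (s (x - p k) (x - p k) - d) * s m m"
    proof (rule quadratic_nonneg_imp_discriminant[OF form_nonneg])
      fix t
      \<comment> \<open>Variation of \<open>p k\<close> in direction \<open>m\<close>; the sign
        \<open>- t\<close> makes the linear coefficient \<open>2 * s (x - p k) m\<close>.\<close>
      have "d \<le> s (x - (p k + (- t) *\<^sub>R m)) (x - (p k + (- t) *\<^sub>R m))"
        by (rule lower[OF graph_add[OF pw(1) graph_scaleR[OF m]]])
      then show "0 \<le> s (x - p k) (x - p k) - d + 2 * s (x - p k) m * t + s m m * t\<^sup>2"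
        using form_commute[of m x] form_commute[of m "p k"]
        by (simp add: form_add_left form_add_right form_diff_left form_diff_right
          form_scaleR_left form_scaleR_right algebra_simps power2_eq_square)
    qed
    also have "\<dots> \<le> inverse (real (Suc k)) * s m m"
      using pw(2)[of k] by (intro mult_right_mono form_nonneg) simp
    finally have "sqrt ((s (x - p k) m)\<^sup>2) \<le> sqrt (inverse (real (Suc k)) * s m m)"
      by (rule real_sqrt_le_mono)
    then show ?thesis by (simp only: e_def seminorm_def real_sqrt_mult real_sqrt_abs)
  qed
  have close: "norm (w k - w l) \<le> e k + e l" for k l
  proof -
    let ?m = "p k - p l"
    have g: "(?m, w k - w l) \<in> \<Gamma>" using pw graph_diff by blast
    \<comment> \<open>Both orthogonality defects are tested against \<open>p k - p l\<close>, which
      lies in the domain.\<close>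
    have "seminorm ?m * seminorm ?m = s (x - p l) ?m - s (x - p k) ?m"
      using seminorm_square[of ?m] by (simp add: power2_eq_square form_diff_left)
    also have "\<dots> \<le> (e k + e l) * seminorm ?m"
      using asym[OF g, of k] asym[OF g, of l] by (simp add: algebra_simps)
    finally have "seminorm ?m \<le> e k + e l"
      by (rule le_of_mult_self_le) (simp_all add: e_def)
    with norm_le_seminorm[OF g] show ?thesis by (rule order_trans)
  qed
  have "Cauchy w"
  proof (rule CauchyI)
    fix \<epsilon> :: real assume "0 < \<epsilon>"
    then have "\<forall>\<^sub>F k in sequentially. e k < \<epsilon> / 2" using e0 by (intro order_tendstoD(2)) auto
    then obtain K where "\<And>k. k \<ge> K \<Longrightarrow> e k < \<epsilon> / 2" unfolding eventually_sequentially by blast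
    then show "\<exists>M. \<forall>m\<ge>M. \<forall>n\<ge>M. norm (w m - w n) < \<epsilon>"
      by (smt (verit) close field_sum_of_halves)
  qed
  then obtain y where "w \<longlonglongrightarrow> y" using Cauchy_convergent_iff convergent_def by blast
  with pw(1) e0 asym show ?thesis unfolding approx_def by blast
qed

text \<open>\<open>Z\<close> is the graph map composed with the projection onto the completed
  domain. Its linearity comes from uniqueness of the approximate value. The closure statement
  transfers orthogonality properties of the graph values to all values of \<open>Z\<close>.\<close>

theorem dominated_extension:
  obtains Z where "\<And>x y. Z (x + y) = Z x + Z y" "\<And>a x. Z (a *\<^sub>C x) = a *\<^sub>C Z x"
    "\<And>x. (norm (Z x))\<^sup>2 \<le> s x x" "\<And>x. Z x \<in> closure (snd ` \<Gamma>)"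
    "\<And>m z. (m, z) \<in> \<Gamma> \<Longrightarrow> Z m = z"
proof -
  obtain Z where Z: "\<And>x. approx x (Z x)" using approx_exists by metis
  show thesis
  proof (rule that[of Z])
    show "Z (x + y) = Z x + Z y" for x y by (meson Z approx_add approx_unique)
    show "Z (a *\<^sub>C x) = a *\<^sub>C Z x" for a x by (meson Z approx_scaleC approx_unique)
    show "(norm (Z x))\<^sup>2 \<le> s x x" for x
      using power_mono[OF approx_norm_le[OF Z] norm_ge_zero, of x 2] by (simp add: seminorm_square)
    show "Z x \<in> closure (snd ` \<Gamma>)" for x by (rule approx_in_closure[OF Z])
    show "Z m = z" if "(m, z) \<in> \<Gamma>" for m z using Z approx_graph[OF that] approx_unique by blast
  qed
qed

end

section \<open>Projections and adjoints\<close>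

lemma cinner_scaleC_right: "cinner x (a *\<^sub>C y) = cnj a * cinner x y"
  by (metis cinner_commute cinner_scaleC_left complex_cnj_mult)

lemma cinner_add_right: "cinner x (y + z) = cinner x y + cinner x z"
  by (metis cinner_add_left cinner_commute complex_cnj_add)

lemma cinner_diff_left: "cinner (x - y) z = cinner x z - cinner y z"
  using cinner_add_left[of "x - y" y z] by simp

lemma cinner_diff_right: "cinner z (x - y) = cinner z x - cinner z y"
  using cinner_add_right[of z "x - y" y] by simp

lemma inner_scaleC_left: "inner (a *\<^sub>C x) y = inner x (cnj a *\<^sub>C y)"
  by (simp add: inner_eq_Re_cinner cinner_scaleC_left cinner_scaleC_right)

text \<open>Conjugate-linearity in the second argument expresses the imaginary part through the real
  inner product. Hence real and complex orthogonality to a complex subspace coincide.\<close>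

lemma cinner_eq_Complex: "cinner x y = Complex (inner x y) (inner x (\<i> *\<^sub>C y))"
  by (simp add: inner_eq_Re_cinner cinner_scaleC_right complex_eq_iff)

lemma cinner_eq_self: "cinner x x = complex_of_real ((norm x)\<^sup>2)"
proof -
  have "cinner x x = cnj (cinner x x)" by (rule cinner_commute)
  then have "Im (cinner x x) = 0" by (metis cnj.simps(2) neg_equal_zero)
  then show ?thesis by (simp add: complex_eq_iff power2_norm_eq_inner inner_eq_Re_cinner)
qed

text \<open>The factor 2 comes from bounding real and imaginary parts separately. It suffices to
  make \<open>cinner (f x) y\<close> a bounded functional of \<open>x\<close>.\<close>

lemma cmod_cinner_le: "cmod (cinner x y) \<le> 2 * (norm x * norm y)"
proof -
  have "cmod (cinner x y) \<le> \<bar>inner x y\<bar> + \<bar>inner x (\<i> *\<^sub>C y)\<bar>"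
    using cmod_le[of "cinner x y"] by (simp add: cinner_eq_Complex[of x y])
  also have "\<dots> \<le> norm x * norm y + norm x * norm (\<i> *\<^sub>C y)"
    by (intro add_mono Cauchy_Schwarz_ineq2)
  finally show ?thesis by (simp add: norm_scaleC)
qed

section \<open>Closed subspaces and bounded operators on them\<close>

lemma closed_csubspaceD:
  assumes "closed_csubspace S"
  shows "0 \<in> S" "x \<in> S \<Longrightarrow> y \<in> S \<Longrightarrow> x + y \<in> S" "x \<in> S \<Longrightarrow> a *\<^sub>C x \<in> S"
    "x \<in> S \<Longrightarrow> y \<in> S \<Longrightarrow> x - y \<in> S" "closed S"
proof -
  show *: "0 \<in> S" "x \<in> S \<Longrightarrow> y \<in> S \<Longrightarrow> x + y \<in> S" "closed S" for x y
    using assms by (auto simp: closed_csubspace_def)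
  show sc: "x \<in> S \<Longrightarrow> a *\<^sub>C x \<in> S" for a x
    using assms by (auto simp: closed_csubspace_def)
  show "x - y \<in> S" if "x \<in> S" "y \<in> S"
    using *(2)[OF that(1) sc[OF that(2), of "complex_of_real (-1)"]]
    unfolding scaleC_of_real by simp
qed

lemma bounded_opsD:
  assumes "f \<in> bounded_ops S R"
  shows "x \<in> S \<Longrightarrow> f x \<in> R" "x \<in> S \<Longrightarrow> y \<in> S \<Longrightarrow> f (x + y) = f x + f y"
    "x \<in> S \<Longrightarrow> f (a *\<^sub>C x) = a *\<^sub>C f x" "\<exists>M\<ge>0. \<forall>x\<in>S. norm (f x) \<le> M * norm x"
proof -
  show "x \<in> S \<Longrightarrow> f x \<in> R" "x \<in> S \<Longrightarrow> y \<in> S \<Longrightarrow> f (x + y) = f x + f y"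
    "x \<in> S \<Longrightarrow> f (a *\<^sub>C x) = a *\<^sub>C f x"
    using assms by (auto simp: bounded_ops_def)
  obtain M where "\<forall>x\<in>S. norm (f x) \<le> M * norm x"
    using assms by (auto simp: bounded_ops_def)
  then have "\<forall>x\<in>S. norm (f x) \<le> \<bar>M\<bar> * norm x"
    by (meson abs_ge_self mult_right_mono norm_ge_zero order_trans)
  then show "\<exists>M\<ge>0. \<forall>x\<in>S. norm (f x) \<le> M * norm x" by (metis abs_ge_zero)
qed

lemma bounded_ops_diff:
  assumes "closed_csubspace S" "f \<in> bounded_ops S R" "x \<in> S" "y \<in> S"
  shows "f (x - y) = f x - f y"
  using bounded_opsD(2)[OF assms(2) closed_csubspaceD(4)[OF assms(1,3,4)] assms(4)] by simp

lemma bounded_ops_zero: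
  assumes "closed_csubspace S" "f \<in> bounded_ops S R"
  shows "f 0 = 0"
  using bounded_opsD(2)[OF assms(2), of 0 0] closed_csubspaceD(1)[OF assms(1)] by simp

lemma closed_csubspace_UNIV: "closed_csubspace UNIV"
  by (simp add: closed_csubspace_def)

lemma bounded_ops_UNIV_imp_bounded_linear:
  assumes "f \<in> bounded_ops UNIV R"
  shows "bounded_linear f"
proof -
  obtain M where "\<forall>x. norm (f x) \<le> M * norm x" using bounded_opsD(4)[OF assms] by auto
  moreover have "f (r *\<^sub>R x) = r *\<^sub>R f x" for r x
    using bounded_opsD(3)[OF assms, of x "complex_of_real r"] by (simp add: scaleC_of_real)
  ultimately show ?thesis
    by (intro bounded_linear_intro[of f M]) (auto simp: bounded_opsD(2)[OF assms] mult.commute)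
qed

lemma cinner_zero_if_inner_zero:
  assumes "closed_csubspace S" "\<forall>z\<in>S. inner x z = 0" "z \<in> S"
  shows "cinner x z = 0"
  using assms closed_csubspaceD(3)[OF assms(1,3)] by (simp add: cinner_eq_Complex zero_complex.code)

text \<open>Extending the identity of \<open>S\<close>, dominated by \<open>inner\<close>, gives a
  contraction \<open>Z\<close> onto \<open>S\<close> fixing \<open>S\<close>. Such a map is an
  orthogonal projection: if \<open>Z u = 0\<close> and \<open>z\<close> is in \<open>S\<close>, then
  \<open>Z (u + t *\<^sub>R z) = t *\<^sub>R z\<close>, and contractivity for all \<open>t\<close>
  forces \<open>inner u z = 0\<close>.\<close>

lemma orthogonal_projection_exists:
  assumes S: "closed_csubspace S"
  shows "\<exists>y\<in>S. \<forall>z\<in>S. inner (x - y) z = 0"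
proof -
  interpret dominated_graph inner "Id_on S"
    by standard (auto simp: inner_add_left inner_scaleC_left closed_csubspaceD[OF S]
        power2_norm_eq_inner intro: inner_commute)
  obtain Z where Z: "\<And>x y. Z (x + y) = Z x + Z y" "\<And>a x. Z (a *\<^sub>C x) = a *\<^sub>C Z x"
    "\<And>x. (norm (Z x))\<^sup>2 \<le> inner x x"
    "\<And>x. Z x \<in> closure (snd ` Id_on S)" "\<And>m z. (m, z) \<in> Id_on S \<Longrightarrow> Z m = z"
    by (rule dominated_extension) (blast intro: that)
  have "snd ` Id_on S = S" by (force simp: Id_on_def)
  then have ZS: "Z x \<in> S" for x using Z(4)[of x] closed_csubspaceD(5)[OF S] by simp
  define u where "u = x - Z x"
  have "Z u + Z (Z x) = Z x" using Z(1)[of u "Z x"] by (simp add: u_def)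
  then have Zu: "Z u = 0" using ZS Z(5) by (simp add: Id_on_iff)
  have "inner u z = 0" if "z \<in> S" for z
  proof -
    have "(inner u z)\<^sup>2 \<le> inner u u * 0"
    proof (rule quadratic_nonneg_imp_discriminant)
      fix t
      have tz: "t *\<^sub>R z \<in> S" using closed_csubspaceD(3)[OF S that] by (metis scaleC_of_real)
      have "Z (u + t *\<^sub>R z) = t *\<^sub>R z" using Z(1) Zu Z(5) tz by (simp add: Id_on_iff)
      then have "t\<^sup>2 * inner z z \<le> inner (u + t *\<^sub>R z) (u + t *\<^sub>R z)"
        using Z(3)[of "u + t *\<^sub>R z"] by (simp add: power_mult_distrib flip: power2_norm_eq_inner)
      also have "\<dots> = inner u u + 2 * inner u z * t + t\<^sup>2 * inner z z"
        by (simp add: inner_add_left inner_add_right inner_commute[of z u] algebra_simps power2_eq_square)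
      finally show "0 \<le> inner u u + 2 * inner u z * t + 0 * t\<^sup>2" by simp
    qed simp
    then show ?thesis by simp
  qed
  with ZS show ?thesis unfolding u_def by blast
qed

text \<open>\<open>orth_proj\<close> is specified by \<open>cinner\<close>, while later arguments
  use \<open>inner\<close>; on a complex subspace the two conditions agree. The difference of two
  candidates lies in \<open>S\<close> and is orthogonal to itself, so the description is
  unique.\<close>

lemma
  assumes S: "closed_csubspace S"
  shows orth_proj_in: "orth_proj S x \<in> S"
    and orth_proj_orthogonal: "z \<in> S \<Longrightarrow> inner (x - orth_proj S x) z = 0"
    and orth_proj_eqI: "y \<in> S \<Longrightarrow> (\<And>z. z \<in> S \<Longrightarrow> inner (x - y) z = 0) \<Longrightarrow> orth_proj S x = y"
proof -
  let ?P = "\<lambda>y. y \<in> S \<and> (\<forall>z\<in>S. cinner (x - y) z = 0)"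
  have uniq: "y = y'" if "?P y" "?P y'" for y y'
  proof -
    have "y - y' \<in> S" using that closed_csubspaceD(4)[OF S] by blast
    then have "cinner (x - y') (y - y') - cinner (x - y) (y - y') = 0" using that by simp
    then have "cinner (y - y') (y - y') = 0" by (simp flip: cinner_diff_left)
    then show ?thesis by (simp add: cinner_eq_self)
  qed
  have I: "?P y" if "y \<in> S" "\<And>z. z \<in> S \<Longrightarrow> inner (x - y) z = 0" for y
    using that cinner_zero_if_inner_zero[OF S] by blast
  obtain y0 where y0: "?P y0" using orthogonal_projection_exists[OF S, of x] I by metis
  have eq: "orth_proj S x = y" if "?P y" for y
    unfolding orth_proj_def by (rule the_equality) (use that uniq in blast)+
  show "orth_proj S x \<in> S" using eq[OF y0] y0 by simp
  show "inner (x - orth_proj S x) z = 0" if "z \<in> S"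
    using eq[OF y0] y0 that by (simp add: inner_eq_Re_cinner)
  show "orth_proj S x = y" if "y \<in> S" "\<And>z. z \<in> S \<Longrightarrow> inner (x - y) z = 0"
    using eq I that by blast
qed

text \<open>The kernel \<open>N\<close> is closed, so a vector outside it has a nonzero component
  \<open>u\<close> orthogonal to \<open>N\<close>. Subtracting the multiple of \<open>u\<close> with
  the same value of \<open>\<phi>\<close> sends any \<open>x\<close> into \<open>N\<close>; pairing
  with \<open>u\<close> then computes \<open>\<phi> x\<close>.\<close>

lemma Riesz_representation:
  fixes \<phi> :: "'a::chilbert_space \<Rightarrow> complex"
  assumes S: "closed_csubspace S" and \<phi>: "\<phi> \<in> bounded_ops S UNIV"
  shows "\<exists>u\<in>S. \<forall>x\<in>S. \<phi> x = cinner x u"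
proof (cases "\<forall>x\<in>S. \<phi> x = 0")
  case True
  have "cinner x 0 = 0" for x :: 'a using cinner_add_right[of x 0 0] by simp
  with True show ?thesis using closed_csubspaceD(1)[OF S] by force
next
  case False
  then obtain x0 where x0: "x0 \<in> S" "\<phi> x0 \<noteq> 0" by blast
  note hom = bounded_opsD(3)[OF \<phi>, unfolded scaleC_complex_def]
  define N where "N = {x \<in> S. \<phi> x = 0}"
  have "closed N" unfolding closed_sequential_limits
  proof (intro allI impI, elim conjE)
    fix w l assume w: "\<forall>n. w n \<in> N" and l: "w \<longlonglongrightarrow> l"
    have lS: "l \<in> S"
      using w l closed_csubspaceD(5)[OF S] unfolding closed_sequential_limits N_def by blast
    obtain M where M: "\<forall>x\<in>S. norm (\<phi> x) \<le> M * norm x" using bounded_opsD(4)[OF \<phi>] by blast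
    have "norm (\<phi> l) \<le> M * norm (l - w n)" for n
      using w lS bounded_ops_diff[OF S \<phi> lS, of "w n"] closed_csubspaceD(4)[OF S lS, of "w n"] M
      by (auto simp: N_def)
    moreover have "(\<lambda>n. M * norm (l - w n)) \<longlonglongrightarrow> M * norm (l - l)"
      by (intro tendsto_intros l)
    ultimately have "norm (\<phi> l) \<le> M * norm (l - l)" by (intro LIMSEQ_le_const) auto
    then show "l \<in> N" using lS by (simp add: N_def)
  qed
  then have N: "closed_csubspace N"
    using closed_csubspaceD[OF S] bounded_ops_zero[OF S \<phi>] bounded_opsD(2)[OF \<phi>] hom
    by (auto simp: closed_csubspace_def N_def)
  define u where "u = x0 - orth_proj N x0"
  have PN: "orth_proj N x0 \<in> S" "\<phi> (orth_proj N x0) = 0"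
    using orth_proj_in[OF N, of x0] by (auto simp: N_def)
  have uS: "u \<in> S" unfolding u_def using x0 PN closed_csubspaceD(4)[OF S] by blast
  have \<phi>u: "\<phi> u \<noteq> 0" unfolding u_def using bounded_ops_diff[OF S \<phi> x0(1) PN(1)] PN x0 by simp
  then have u0: "u \<noteq> 0" using bounded_ops_zero[OF S \<phi>] by auto
  have uN: "cinner u z = 0" if "z \<in> N" for z
    using cinner_zero_if_inner_zero[OF N _ that, of u] orth_proj_orthogonal[OF N] unfolding u_def by blast
  \<comment> \<open>The factor is chosen so that \<open>cinner u v = \<phi> u\<close>; it is
    conjugated because it leaves the second argument.\<close>
  define v where "v = (cnj (\<phi> u) / complex_of_real ((norm u)\<^sup>2)) *\<^sub>C u"
  have "\<phi> x = cinner x v" if xS: "x \<in> S" for x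
  proof -
    let ?y = "(\<phi> x / \<phi> u) *\<^sub>C u"
    have yS: "?y \<in> S" using closed_csubspaceD(3)[OF S uS] .
    have "\<phi> (x - ?y) = 0" using bounded_ops_diff[OF S \<phi> xS yS] hom[OF uS] \<phi>u by simp
    then have "cinner u (x - ?y) = 0" using uN closed_csubspaceD(4)[OF S xS yS] by (simp add: N_def)
    then have "cinner (x - ?y) u = 0" by (metis cinner_commute complex_cnj_zero)
    then have "cinner x u = \<phi> x / \<phi> u * complex_of_real ((norm u)\<^sup>2)"
      by (simp add: cinner_diff_left cinner_scaleC_left cinner_eq_self)
    then show ?thesis using \<phi>u u0 by (simp add: v_def cinner_scaleC_right)
  qed
  moreover have "v \<in> S" unfolding v_def using closed_csubspaceD(3)[OF S uS] .
  ultimately show ?thesis by blast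
qed

text \<open>Riesz representation of \<open>cinner (f x) y\<close> for each fixed \<open>y\<close>;
  linearity follows from uniqueness of the representing vector, boundedness from testing at
  \<open>x = g y\<close>. The conclusion has the shape of the choice in
  \<open>adj_on\<close>.\<close>

lemma adjoint_exists:
  assumes S: "closed_csubspace S" and f: "f \<in> bounded_ops S UNIV"
  shows "\<exists>g. g \<in> bounded_ops UNIV S \<and> (\<forall>x\<in>S. \<forall>y\<in>UNIV. cinner (f x) y = cinner x (g y))"
proof -
  obtain M where M: "0 \<le> M" "\<forall>x\<in>S. norm (f x) \<le> M * norm x" using bounded_opsD(4)[OF f] by blast
  have "\<exists>u\<in>S. \<forall>x\<in>S. cinner (f x) y = cinner x u" for y
  proof (rule Riesz_representation[OF S])
    have "cmod (cinner (f x) y) \<le> (2 * M * norm y) * norm x" if "x \<in> S" for x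
    proof -
      have "norm (f x) * norm y \<le> M * norm x * norm y" using M that by (simp add: mult_right_mono)
      then show ?thesis using cmod_cinner_le[of "f x" y] by (simp add: algebra_simps)
    qed
    then show "(\<lambda>x. cinner (f x) y) \<in> bounded_ops S UNIV"
      unfolding bounded_ops_def
      by (auto simp: bounded_opsD(2,3)[OF f] cinner_add_left cinner_scaleC_left scaleC_complex_def)
  qed
  then obtain g where g: "\<And>y. g y \<in> S" "\<And>x y. x \<in> S \<Longrightarrow> cinner (f x) y = cinner x (g y)"
    by metis
  have eqI: "u = v" if "u \<in> S" "v \<in> S" "\<And>x. x \<in> S \<Longrightarrow> cinner x u = cinner x v" for u v
  proof -
    have "cinner (u - v) (u - v) = 0"
      using that(3)[OF closed_csubspaceD(4)[OF S that(1,2)]] by (simp add: cinner_diff_right)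
    then show ?thesis by (simp add: cinner_eq_self)
  qed
  have "g (x + y) = g x + g y" for x y
    by (rule eqI) (simp_all add: closed_csubspaceD[OF S] g cinner_add_right flip: g(2))
  moreover have "g (a *\<^sub>C x) = a *\<^sub>C g x" for a x
    by (rule eqI) (simp_all add: closed_csubspaceD[OF S] g cinner_scaleC_right flip: g(2))
  moreover have "norm (g y) \<le> M * norm y" for y
  proof (rule le_of_mult_self_le)
    have "norm (g y) * norm (g y) = Re (cinner (g y) (g y))"
      by (simp add: cinner_eq_self power2_eq_square)
    also have "\<dots> = inner (f (g y)) y" by (simp add: inner_eq_Re_cinner g flip: g(2))
    also have "\<dots> \<le> norm (f (g y)) * norm y" by (rule norm_cauchy_schwarz)
    also have "\<dots> \<le> (M * norm (g y)) * norm y" using M g(1) by (simp add: mult_right_mono)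
    finally show "norm (g y) * norm (g y) \<le> M * norm y * norm (g y)" by (simp add: mult_ac)
  qed (use M in auto)
  ultimately have "g \<in> bounded_ops UNIV S" using g(1) unfolding bounded_ops_def by blast
  with g show ?thesis by blast
qed

lemma cinner_adj_on:
  assumes "closed_csubspace S" "f \<in> bounded_ops S UNIV" "x \<in> S"
  shows "cinner (f x) y = cinner x (adj_on S UNIV f y)"
  using someI_ex[OF adjoint_exists[OF assms(1,2)]] assms(3) unfolding adj_on_def by blast

text \<open>Pairing each product with \<open>x\<close> turns it into a squared norm.\<close>

lemma op_le_on_adj_imp_norm_le:
  fixes f g :: "'a::chilbert_space \<Rightarrow> 'b::chilbert_space"
  assumes S: "closed_csubspace S" and f: "f \<in> bounded_ops S UNIV" and g: "g \<in> bounded_ops S UNIV"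
    and le: "op_le_on S (\<lambda>x. adj_on S UNIV f (f x)) (\<lambda>x. adj_on S UNIV g (g x))"
    and x: "x \<in> S"
  shows "norm (f x) \<le> norm (g x)"
proof -
  have *: "cinner (adj_on S UNIV h (h x)) x = complex_of_real ((norm (h x))\<^sup>2)"
    if "h \<in> bounded_ops S UNIV" for h :: "'a \<Rightarrow> 'b"
    by (subst cinner_commute) (simp add: cinner_eq_self flip: cinner_adj_on[OF S that x])
  have "cinner (adj_on S UNIV g (g x)) x - cinner (adj_on S UNIV f (f x)) x \<in> \<real>\<^sub>\<ge>\<^sub>0"
    using le x unfolding op_le_on_def by (simp add: cinner_diff_left)
  then have "(norm (f x))\<^sup>2 \<le> (norm (g x))\<^sup>2"
    unfolding *[OF f] *[OF g] by (simp add: complex_nonneg_Reals_iff)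
  then show ?thesis by (rule power2_le_imp_le) simp
qed

section \<open>Successive lifting\<close>

lemma closed_orthogonal_comp: "closed (W\<^sup>\<bottom>)"
proof -
  have "W\<^sup>\<bottom> = (\<Inter>y\<in>W. {x. inner y x = 0})"
    by (auto simp: orthogonal_comp_def orthogonal_def)
  then show ?thesis by (auto intro!: closed_INT closed_Collect_eq continuous_intros)
qed

lemma orthogonal_compI: "(\<And>y. y \<in> W \<Longrightarrow> inner y x = 0) \<Longrightarrow> x \<in> W\<^sup>\<bottom>"
  by (simp add: orthogonal_comp_def orthogonal_def)

lemma orthogonal_compD: "x \<in> W\<^sup>\<bottom> \<Longrightarrow> y \<in> W \<Longrightarrow> inner y x = 0"
  by (simp add: orthogonal_comp_def orthogonal_def)

lemma norm_add_orthogonal_comp: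
  assumes "y \<in> W\<^sup>\<bottom>" "x \<in> W"
  shows "(norm (x + y))\<^sup>2 = (norm x)\<^sup>2 + (norm y)\<^sup>2"
  using assms by (intro norm_add_Pythagorean) (simp add: orthogonal_comp_def)

text \<open>Serves to add finite sums over different index sets by extending the families by zero.
  Additivity is asked only at the given vectors, since the operators concerned are additive only on
  \<open>G i\<close>.\<close>

lemma sum_Un_add_extended:
  fixes u :: "'i \<Rightarrow> 'a::monoid_add \<Rightarrow> 'b::comm_monoid_add"
  assumes fin: "finite F" "finite F'"
    and zero: "\<And>i. i \<in> F \<union> F' \<Longrightarrow> u i 0 = 0"
    and add: "\<And>i. i \<in> F \<Longrightarrow> i \<in> F' \<Longrightarrow> u i (g i + g' i) = u i (g i) + u i (g' i)"
  shows "(\<Sum>i\<in>F \<union> F'. u i ((if i \<in> F then g i else 0) + (if i \<in> F' then g' i else 0)))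
    = (\<Sum>i\<in>F. u i (g i)) + (\<Sum>i\<in>F'. u i (g' i))"
proof -
  have "(\<Sum>i\<in>F \<union> F'. u i ((if i \<in> F then g i else 0) + (if i \<in> F' then g' i else 0)))
    = (\<Sum>i\<in>F \<union> F'. (if i \<in> F then u i (g i) else 0) + (if i \<in> F' then u i (g' i) else 0))"
    using zero add by (intro sum.cong) auto
  also have "\<dots> = (\<Sum>i\<in>(F \<union> F') \<inter> F. u i (g i)) + (\<Sum>i\<in>(F \<union> F') \<inter> F'. u i (g' i))"
    unfolding sum.distrib using fin by (simp only: sum.inter_restrict finite_Un simp_thms)
  also have "\<dots> = (\<Sum>i\<in>F. u i (g i)) + (\<Sum>i\<in>F'. u i (g' i))"
    by (simp add: Int_absorb1)
  finally show ?thesis .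
qed

text \<open>The data in terms of real inner products. The operators of the row contraction enter
  through \<open>V_invariant\<close> and through the condition on the initial operator at stage 0;
  \<open>c\<close> will be the norm of that operator.\<close>

locale lifting_problem =
  fixes I :: "nat set"
    and H :: "'k::chilbert_space set"
    and G :: "nat \<Rightarrow> 'g::chilbert_space set"
    and V :: "nat \<Rightarrow> 'k \<Rightarrow> 'k"
    and Q C :: "nat \<Rightarrow> 'g \<Rightarrow> 'x::chilbert_space"
    and c :: real
  assumes c_nonneg: "0 \<le> c"
    and V_ops: "i \<in> I \<Longrightarrow> V i \<in> bounded_ops UNIV UNIV"
    and V_isometric: "i \<in> I \<Longrightarrow> inner (V i x) (V i y) = inner x y"
    and V_orthogonal: "i \<in> I \<Longrightarrow> j \<in> I \<Longrightarrow> i \<noteq> j \<Longrightarrow> inner (V i x) (V j y) = 0"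
    and V_adjoint: "i \<in> I \<Longrightarrow> \<exists>w. \<forall>x. inner (V i x) y = inner x w"
    and V_invariant: "i \<in> I \<Longrightarrow> y \<in> H\<^sup>\<bottom> \<Longrightarrow> V i y \<in> H\<^sup>\<bottom>"
    and G_closed: "i \<in> I \<Longrightarrow> closed_csubspace (G i)"
    and Q_ops: "i \<in> I \<Longrightarrow> Q i \<in> bounded_ops (G i) UNIV"
    and C_ops: "i \<in> I \<Longrightarrow> C i \<in> bounded_ops (G i) UNIV"
    and Q_orthogonal: "i \<in> I \<Longrightarrow> j \<in> I \<Longrightarrow> i \<noteq> j \<Longrightarrow> g \<in> G i \<Longrightarrow> g' \<in> G j \<Longrightarrow>
          inner (Q i g) (Q j g') = 0"
    and C_le_Q: "i \<in> I \<Longrightarrow> g \<in> G i \<Longrightarrow> norm (C i g) \<le> norm (Q i g)"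
begin

text \<open>Only a spanning set, indexed by words of length at most \<open>m\<close>; the closed
  span is its double orthogonal complement. \<open>H\<close> reappears in the successor for the
  empty word.\<close>

primrec stage :: "nat \<Rightarrow> 'k set"
  where "stage 0 = H"
  | "stage (Suc m) = H \<union> (\<Union>i\<in>I. V i ` stage m)"

lemma stage_mono: "stage m \<subseteq> stage (Suc m)"
proof (induction m)
  case (Suc m)
  then have "H \<union> (\<Union>i\<in>I. V i ` stage m) \<subseteq> H \<union> (\<Union>i\<in>I. V i ` stage (Suc m))"
    by blast
  then show ?case by (simp only: stage.simps)
qed simp

lemma stage_perp_anti_mono: "m \<le> l \<Longrightarrow> (stage l)\<^sup>\<bottom> \<subseteq> (stage m)\<^sup>\<bottom>"
  by (rule orthogonal_comp_anti_mono, rule lift_Suc_mono_le[of stage], rule stage_mono)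

text \<open>A generator of the next stage is in \<open>H\<close>, where invariance of
  \<open>H\<^sup>\<bottom>\<close> applies, or in the range of some \<open>V j\<close>, where
  isometry or orthogonality of ranges applies.\<close>

lemma V_stage_perp:
  assumes i: "i \<in> I" and y: "y \<in> (stage m)\<^sup>\<bottom>"
  shows "V i y \<in> (stage (Suc m))\<^sup>\<bottom>"
proof (rule orthogonal_compI)
  fix k assume "k \<in> stage (Suc m)"
  then consider "k \<in> H" | j l where "j \<in> I" "l \<in> stage m" "k = V j l" by auto
  then show "inner k (V i y) = 0"
  proof cases
    case 1
    moreover have "V i y \<in> H\<^sup>\<bottom>"
      using V_invariant[OF i] stage_perp_anti_mono[of 0 m] y by auto
    ultimately show ?thesis using orthogonal_compD by blast
  next
    case 2
    then show ?thesis
      using orthogonal_compD[OF y] V_isometric[OF i] V_orthogonal[OF _ i] by (cases "j = i") auto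
  qed
qed

text \<open>Since \<open>V i\<close> maps \<open>stage m\<close> into \<open>stage (Suc m)\<close>,
  its adjoint maps the complement of the latter into that of the former.\<close>

lemma V_stage_perp_perp:
  assumes i: "i \<in> I" and y: "y \<in> (stage m)\<^sup>\<bottom>\<^sup>\<bottom>"
  shows "V i y \<in> (stage (Suc m))\<^sup>\<bottom>\<^sup>\<bottom>"
proof (rule orthogonal_compI)
  fix k assume k: "k \<in> (stage (Suc m))\<^sup>\<bottom>"
  obtain w where w: "\<And>x. inner (V i x) k = inner x w" using V_adjoint[OF i] by blast
  have "w \<in> (stage m)\<^sup>\<bottom>"
  proof (rule orthogonal_compI)
    fix l assume "l \<in> stage m"
    then have "V i l \<in> stage (Suc m)" using i by auto
    from orthogonal_compD[OF k this] show "inner l w = 0" by (simp add: w)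
  qed
  from orthogonal_compD[OF y this] show "inner k (V i y) = 0"
    using w[of y] by (simp add: inner_commute)
qed

text \<open>The last clause says that \<open>B (Q i g)\<close> is the compression of
  \<open>V i (B (C i g))\<close> to the closed span of the stage. For \<open>m = 0\<close> and
  \<open>B = A\<close> this is the hypothesis \<open>T i (A (C i g)) = A (Q i g)\<close>.\<close>

definition partial_lift :: "nat \<Rightarrow> ('x \<Rightarrow> 'k) \<Rightarrow> bool"
  where "partial_lift m B \<longleftrightarrow> B \<in> bounded_ops UNIV UNIV \<and> (\<forall>x. norm (B x) \<le> c * norm x) \<and>
    (\<forall>x. B x \<in> (stage m)\<^sup>\<bottom>\<^sup>\<bottom>) \<and>
    (\<forall>i\<in>I. \<forall>g\<in>G i. V i (B (C i g)) - B (Q i g) \<in> (stage m)\<^sup>\<bottom>)"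

text \<open>
  The next approximation is \<open>B + Z\<close>. The intertwining relation prescribes \<open>Z\<close> on the
  ranges of the \<open>Q i\<close>, where it is dominated by the form
  \<open>c\<^sup>2\<langle>x, y\<rangle> - \<langle>B x, B y\<rangle>\<close>; the extension keeps the norm of \<open>B + Z\<close>
  below \<open>c\<close> because the values of \<open>Z\<close> are orthogonal to those of \<open>B\<close>.
\<close>

lemma partial_lift_step:
  assumes "partial_lift m B"
  shows "\<exists>B'. partial_lift (Suc m) B' \<and> (\<forall>x. B' x - B x \<in> (stage m)\<^sup>\<bottom>) \<and>
    (\<forall>i\<in>I. \<forall>g\<in>G i. V i (B (C i g)) = B' (Q i g))"
proof -
  have B: "B \<in> bounded_ops UNIV UNIV" and Bc: "\<And>x. norm (B x) \<le> c * norm x"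
    and B_range: "\<And>x. B x \<in> (stage m)\<^sup>\<bottom>\<^sup>\<bottom>"
    and defect: "\<And>i g. i \<in> I \<Longrightarrow> g \<in> G i \<Longrightarrow> V i (B (C i g)) - B (Q i g) \<in> (stage m)\<^sup>\<bottom>"
    using assms unfolding partial_lift_def by auto
  note B_add = bounded_opsD(2)[OF B UNIV_I UNIV_I]
  note B_scaleC = bounded_opsD(3)[OF B UNIV_I]
  interpret B: bounded_linear B by (rule bounded_ops_UNIV_imp_bounded_linear[OF B])
  note V_add = bounded_opsD(2)[OF V_ops UNIV_I UNIV_I]
  note V_scaleC = bounded_opsD(3)[OF V_ops UNIV_I]
  note G0 = closed_csubspaceD(1)[OF G_closed]
  define s where "s x y = c\<^sup>2 * inner x y - inner (B x) (B y)" for x y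
  define D where "D i g = V i (B (C i g)) - B (Q i g)" for i g
  have D0: "D i 0 = 0" if "i \<in> I" for i
    using that by (simp add: D_def bounded_ops_zero[OF G_closed Q_ops] B.zero
        bounded_ops_zero[OF G_closed C_ops] bounded_ops_zero[OF closed_csubspace_UNIV V_ops])
  have D_add: "D i (g + g') = D i g + D i g'" if "i \<in> I" "g \<in> G i" "g' \<in> G i" for i g g'
    using that by (simp add: D_def bounded_opsD(2)[OF Q_ops] bounded_opsD(2)[OF C_ops] B_add V_add)
  have D_scaleC: "D i (a *\<^sub>C g) = a *\<^sub>C D i g" if "i \<in> I" "g \<in> G i" for i g a
    using that by (simp add: D_def bounded_opsD(3)[OF Q_ops] bounded_opsD(3)[OF C_ops]
        B_scaleC V_scaleC scaleC_diff_right)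
  \<comment> \<open>Finite sums suffice even for infinite \<open>I\<close>, as the domain of the
    graph may be non-closed.\<close>
  define graph where "graph = {(\<Sum>i\<in>F. Q i (g i), \<Sum>i\<in>F. D i (g i)) | F g.
    finite F \<and> F \<subseteq> I \<and> (\<forall>i\<in>F. g i \<in> G i)}"
  have graphI: "(\<Sum>i\<in>F. Q i (g i), \<Sum>i\<in>F. D i (g i)) \<in> graph"
    if "finite F" "F \<subseteq> I" "\<And>i. i \<in> F \<Longrightarrow> g i \<in> G i" for F g
    unfolding graph_def using that by blast
  have graphE: "\<exists>F g. finite F \<and> F \<subseteq> I \<and> (\<forall>i\<in>F. g i \<in> G i) \<and>
      p = (\<Sum>i\<in>F. Q i (g i)) \<and> z = (\<Sum>i\<in>F. D i (g i))" if "(p, z) \<in> graph" for p z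
    using that unfolding graph_def by blast
  have graph_perp: "z \<in> (stage m)\<^sup>\<bottom>" if pz: "(p, z) \<in> graph" for p z
  proof -
    obtain F g where F: "F \<subseteq> I" and g: "\<And>i. i \<in> F \<Longrightarrow> g i \<in> G i"
      and z: "z = (\<Sum>i\<in>F. D i (g i))"
      using graphE[OF pz] by blast
    show ?thesis unfolding z D_def using F g
      by (intro subspace_sum subspace_orthogonal_comp defect) auto
  qed
  have form_nonneg: "0 \<le> s x x" for x
    using power_mono[OF Bc[of x] norm_ge_zero, of 2]
    by (simp add: s_def power_mult_distrib flip: power2_norm_eq_inner)
  have graph_dominated: "(norm z)\<^sup>2 \<le> s p p" if pz: "(p, z) \<in> graph" for p z
  proof -
    obtain F g where F: "finite F" "F \<subseteq> I" and g: "\<And>i. i \<in> F \<Longrightarrow> g i \<in> G i"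
      and p: "p = (\<Sum>i\<in>F. Q i (g i))" and z: "z = (\<Sum>i\<in>F. D i (g i))"
      using graphE[OF pz] by blast
    \<comment> \<open>Here \<open>z\<close> is orthogonal to \<open>B p\<close>, and adding
      \<open>B p\<close> cancels the terms \<open>B (Q i (g i))\<close>. What remains is a sum of
      orthogonal vectors, estimated term by term and reassembled by orthogonality of the ranges of
      the \<open>Q i\<close>.\<close>
    have "(norm z)\<^sup>2 + (norm (B p))\<^sup>2 = (norm (z + B p))\<^sup>2"
      using norm_add_orthogonal_comp[OF B_range graph_perp[OF pz]] by simp
    also have "z + B p = (\<Sum>i\<in>F. V i (B (C i (g i))))"
      by (simp add: p z D_def B.sum sum_subtractf)
    also have "(norm \<dots>)\<^sup>2 = (\<Sum>i\<in>F. (norm (V i (B (C i (g i)))))\<^sup>2)"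
      using F by (intro norm_sum_Pythagorean)
        (auto simp: pairwise_def orthogonal_def subset_iff intro!: V_orthogonal)
    also have "\<dots> \<le> (\<Sum>i\<in>F. c\<^sup>2 * (norm (Q i (g i)))\<^sup>2)"
    proof (rule sum_mono)
      fix i assume i: "i \<in> F"
      have "norm (V i (B (C i (g i)))) = norm (B (C i (g i)))"
        using i F V_isometric by (auto simp: norm_eq_sqrt_inner)
      also have "\<dots> \<le> c * norm (Q i (g i))"
        using Bc[of "C i (g i)"] mult_left_mono[OF C_le_Q c_nonneg] i F g by (meson order_trans subsetD)
      finally show "(norm (V i (B (C i (g i)))))\<^sup>2 \<le> c\<^sup>2 * (norm (Q i (g i)))\<^sup>2"
        using power_mono[OF _ norm_ge_zero] by (fastforce simp flip: power_mult_distrib)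
    qed
    also have "\<dots> = c\<^sup>2 * (norm p)\<^sup>2"
    proof -
      have "pairwise (\<lambda>i j. orthogonal (Q i (g i)) (Q j (g j))) F"
        using F g Q_orthogonal by (auto simp: pairwise_def orthogonal_def subset_iff)
      then show ?thesis using F(1) by (simp add: p norm_sum_Pythagorean sum_distrib_left)
    qed
    finally show ?thesis by (simp add: s_def power2_norm_eq_inner)
  qed
  interpret dominated_graph s graph
  proof
    show "s x y = s y x" for x y by (simp add: s_def inner_commute)
    show "s (x + y) u = s x u + s y u" for x y u
      by (simp add: s_def B_add inner_add_left algebra_simps)
    show "s (r *\<^sub>R x) y = r * s x y" for r x y by (simp add: s_def B.scaleR algebra_simps)
    show "s (a *\<^sub>C x) y = s x (cnj a *\<^sub>C y)" for a x y
      by (simp add: s_def B_scaleC inner_scaleC_left)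
    show "0 \<le> s x x" for x by (rule form_nonneg)
    show "(0, 0) \<in> graph" using graphI[of "{}"] by simp
    show "(norm z)\<^sup>2 \<le> s p p" if "(p, z) \<in> graph" for p z by (rule graph_dominated[OF that])
    show "(a *\<^sub>C p, a *\<^sub>C z) \<in> graph" if pz: "(p, z) \<in> graph" for p z a
    proof -
      obtain F g where F: "finite F" "F \<subseteq> I" and g: "\<And>i. i \<in> F \<Longrightarrow> g i \<in> G i"
        and p: "p = (\<Sum>i\<in>F. Q i (g i))" and z: "z = (\<Sum>i\<in>F. D i (g i))"
        using graphE[OF pz] by blast
      have sum: "a *\<^sub>C (\<Sum>i\<in>F. f i) = (\<Sum>i\<in>F. a *\<^sub>C f i)"
        for f :: "nat \<Rightarrow> 'z::complex_inner"
        using F(1) scaleC_add_right[of a 0 "0::'z"]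
        by (induction F) (simp_all add: scaleC_add_right)
      have "a *\<^sub>C p = (\<Sum>i\<in>F. Q i (a *\<^sub>C g i))"
        unfolding p sum using F g bounded_opsD(3)[OF Q_ops] by (intro sum.cong) auto
      moreover have "a *\<^sub>C z = (\<Sum>i\<in>F. D i (a *\<^sub>C g i))"
        unfolding z sum using F g D_scaleC by (intro sum.cong) auto
      moreover have "a *\<^sub>C g i \<in> G i" if "i \<in> F" for i
        using that F g closed_csubspaceD(3)[OF G_closed] by blast
      ultimately show ?thesis using graphI[OF F, of "\<lambda>i. a *\<^sub>C g i"] by simp
    qed
    show "(p + p', z + z') \<in> graph" if pz: "(p, z) \<in> graph" and pz': "(p', z') \<in> graph"
      for p z p' z'
    proof -
      obtain F g where F: "finite F" "F \<subseteq> I" and g: "\<And>i. i \<in> F \<Longrightarrow> g i \<in> G i"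
        and p: "p = (\<Sum>i\<in>F. Q i (g i))" and z: "z = (\<Sum>i\<in>F. D i (g i))"
        using graphE[OF pz] by blast
      obtain F' g' where F': "finite F'" "F' \<subseteq> I" and g': "\<And>i. i \<in> F' \<Longrightarrow> g' i \<in> G i"
        and p': "p' = (\<Sum>i\<in>F'. Q i (g' i))" and z': "z' = (\<Sum>i\<in>F'. D i (g' i))"
        using graphE[OF pz'] by blast
      let ?h = "\<lambda>i. (if i \<in> F then g i else 0) + (if i \<in> F' then g' i else 0)"
      have "(\<Sum>i\<in>F \<union> F'. Q i (?h i)) = p + p'" unfolding p p'
        using F F' g g' bounded_ops_zero[OF G_closed Q_ops] bounded_opsD(2)[OF Q_ops]
        by (intro sum_Un_add_extended) auto
      moreover have "(\<Sum>i\<in>F \<union> F'. D i (?h i)) = z + z'" unfolding z z'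
        using F F' g g' D0 D_add by (intro sum_Un_add_extended) auto
      moreover have "?h i \<in> G i" if "i \<in> F \<union> F'" for i
        using that F F' g g' G0[of i] closed_csubspaceD(2)[OF G_closed[of i]] by auto
      ultimately show ?thesis using graphI[of "F \<union> F'" ?h] F F' by simp
    qed
  qed
  obtain Z where Z_add: "\<And>x y. Z (x + y) = Z x + Z y"
    and Z_scaleC: "\<And>a x. Z (a *\<^sub>C x) = a *\<^sub>C Z x"
    and Z_le: "\<And>x. (norm (Z x))\<^sup>2 \<le> s x x" and Z_closure: "\<And>x. Z x \<in> closure (snd ` graph)"
    and Z_graph: "\<And>p z. (p, z) \<in> graph \<Longrightarrow> Z p = z"
    by (rule dominated_extension) (blast intro: that)
  have Z_perp: "Z x \<in> (stage m)\<^sup>\<bottom>" for x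
    using closure_minimal[OF _ closed_orthogonal_comp, of "snd ` graph" "stage m"]
      Z_closure[of x] graph_perp by force
  have stage_Suc: "B x \<in> (stage (Suc m))\<^sup>\<bottom>\<^sup>\<bottom>" for x
    using B_range orthogonal_comp_anti_mono[OF stage_perp_anti_mono[of m "Suc m"]] by auto
  \<comment> \<open>Each \<open>D i g\<close> is a difference of a vector moved up one stage by
    \<open>V i\<close> and a value of \<open>B\<close>, which already lies in the smaller
    span.\<close>
  have "z \<in> (stage (Suc m))\<^sup>\<bottom>\<^sup>\<bottom>" if pz: "(p, z) \<in> graph" for p z
  proof -
    obtain F g where F: "finite F" "F \<subseteq> I" and g: "\<And>i. i \<in> F \<Longrightarrow> g i \<in> G i"
      and z: "z = (\<Sum>i\<in>F. D i (g i))"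
      using graphE[OF pz] by blast
    show ?thesis unfolding z D_def using F g
      by (intro subspace_sum subspace_orthogonal_comp subspace_diff stage_Suc
          V_stage_perp_perp B_range) auto
  qed
  then have Z_perp_perp: "Z x \<in> (stage (Suc m))\<^sup>\<bottom>\<^sup>\<bottom>" for x
    using closure_minimal[OF _ closed_orthogonal_comp, of "snd ` graph" "(stage (Suc m))\<^sup>\<bottom>"]
      Z_closure[of x] by force
  have Z_Q: "Z (Q i g) = D i g" if "i \<in> I" "g \<in> G i" for i g
    using graphI[of "{i}" "\<lambda>_. g"] that Z_graph by simp
  define B' where "B' x = B x + Z x" for x
  have B'_Q: "V i (B (C i g)) = B' (Q i g)" if "i \<in> I" "g \<in> G i" for i g
    using Z_Q[OF that] by (simp add: B'_def D_def)
  have B'c: "norm (B' x) \<le> c * norm x" for x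
  proof -
    have "(norm (B' x))\<^sup>2 = (norm (Z x))\<^sup>2 + (norm (B x))\<^sup>2"
      using norm_add_orthogonal_comp[OF B_range Z_perp] unfolding B'_def by (metis add.commute)
    also have "\<dots> \<le> s x x + (norm (B x))\<^sup>2" using Z_le by simp
    also have "\<dots> = (c * norm x)\<^sup>2" by (simp add: s_def power_mult_distrib power2_norm_eq_inner)
    finally show ?thesis by (rule power2_le_imp_le) (simp add: c_nonneg)
  qed
  have "B' \<in> bounded_ops UNIV UNIV"
    unfolding bounded_ops_def using B'c
    by (auto simp: B'_def B_add B_scaleC Z_add Z_scaleC scaleC_add_right)
  moreover have "B' x \<in> (stage (Suc m))\<^sup>\<bottom>\<^sup>\<bottom>" for x
    unfolding B'_def by (intro subspace_add subspace_orthogonal_comp stage_Suc Z_perp_perp)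
  \<comment> \<open>By \<open>B'_Q\<close> this difference equals \<open>V i (Z (C i g))\<close>,
    and \<open>V i\<close> carries the complement of one stage into that of the next.\<close>
  moreover have "V i (B' (C i g)) - B' (Q i g) \<in> (stage (Suc m))\<^sup>\<bottom>" if "i \<in> I" "g \<in> G i" for i g
    using V_stage_perp[OF that(1) Z_perp, of "C i g"] V_add[OF that(1), of "B (C i g)" "Z (C i g)"]
    unfolding B'_Q[OF that, symmetric] by (simp add: B'_def del: stage.simps)
  ultimately have "partial_lift (Suc m) B'" using B'c unfolding partial_lift_def by blast
  moreover have "B' x - B x \<in> (stage m)\<^sup>\<bottom>" for x using Z_perp by (simp add: B'_def)
  ultimately show ?thesis using B'_Q by blast
qed

text \<open>By Pythagoras, squared distances along the sequence are differences of squared norms,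
  which increase and are bounded; hence pointwise convergence.\<close>

theorem lift_exists:
  assumes "partial_lift 0 A"
  obtains B where "B \<in> bounded_ops UNIV UNIV" "\<And>x. norm (B x) \<le> c * norm x"
    "\<And>x. B x - A x \<in> H\<^sup>\<bottom>" "\<And>i g. i \<in> I \<Longrightarrow> g \<in> G i \<Longrightarrow> V i (B (C i g)) = B (Q i g)"
proof -
  \<comment> \<open>The clause for \<open>m = 0\<close> makes the chosen sequence start at
    \<open>A\<close>.\<close>
  let ?P = "\<lambda>m f. (m = 0 \<longrightarrow> f = A) \<and> partial_lift m f"
  let ?R = "\<lambda>m f f'. (\<forall>x. f' x - f x \<in> (stage m)\<^sup>\<bottom>) \<and>
    (\<forall>i\<in>I. \<forall>g\<in>G i. V i (f (C i g)) = f' (Q i g))"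
  have "\<exists>b. \<forall>m. ?P m (b m) \<and> ?R m (b m) (b (Suc m))"
  proof (rule dependent_nat_choice)
    show "\<exists>f. ?P 0 f" using assms by blast
    show "\<exists>f'. ?P (Suc m) f' \<and> ?R m f f'" if "?P m f" for f m
      using partial_lift_step[of m f] that by blast
  qed
  then obtain b where b: "b 0 = A" "\<And>m. partial_lift m (b m)"
    "\<And>m x. b (Suc m) x - b m x \<in> (stage m)\<^sup>\<bottom>"
    "\<And>m i g. i \<in> I \<Longrightarrow> g \<in> G i \<Longrightarrow> V i (b m (C i g)) = b (Suc m) (Q i g)"
    by metis
  have ops: "b m \<in> bounded_ops UNIV UNIV" and le: "norm (b m x) \<le> c * norm x"
    and range: "b m x \<in> (stage m)\<^sup>\<bottom>\<^sup>\<bottom>" for m x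
    using b(2) unfolding partial_lift_def by auto
  have diff: "b l x - b m x \<in> (stage m)\<^sup>\<bottom>" if "m \<le> l" for m l x
    using that
  proof (induction l rule: dec_induct)
    case base
    show ?case by (simp add: subspace_0 subspace_orthogonal_comp)
  next
    case (step l)
    have "b (Suc l) x - b l x \<in> (stage m)\<^sup>\<bottom>" using b(3) stage_perp_anti_mono step(1) by blast
    from subspace_add[OF subspace_orthogonal_comp this step(3)] show ?case by simp
  qed
  have pyth: "(norm (b l x - b m x))\<^sup>2 = (norm (b l x))\<^sup>2 - (norm (b m x))\<^sup>2" if "m \<le> l" for m l x
    using norm_add_orthogonal_comp[OF range diff[OF that], of x x] by simp
  have "convergent (\<lambda>m. b m x)" for x
  proof -
    have "convergent (\<lambda>m. (norm (b m x))\<^sup>2)"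
    proof (rule Bseq_mono_convergent)
      show "Bseq (\<lambda>m. (norm (b m x))\<^sup>2)"
        using power_mono[OF le norm_ge_zero] by (intro BseqI'[where K = "(c * norm x)\<^sup>2"]) simp
      show "\<forall>m l. m \<le> l \<longrightarrow> (norm (b m x))\<^sup>2 \<le> (norm (b l x))\<^sup>2"
        using pyth by (metis diff_ge_0_iff_ge zero_le_power2)
    qed
    then have cau: "Cauchy (\<lambda>m. (norm (b m x))\<^sup>2)" by (rule convergent_Cauchy)
    have "Cauchy (\<lambda>m. b m x)"
    proof (rule CauchyI)
      fix e :: real assume e: "0 < e"
      then obtain M where M: "\<And>m l. m \<ge> M \<Longrightarrow> l \<ge> M \<Longrightarrow> norm ((norm (b m x))\<^sup>2 - (norm (b l x))\<^sup>2) < e\<^sup>2"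
        using CauchyD[OF cau, of "e\<^sup>2"] by auto
      have "norm (b m x - b l x) < e" if "m \<ge> M" "l \<ge> M" for m l
      proof (rule power2_less_imp_less)
        show "(norm (b m x - b l x))\<^sup>2 < e\<^sup>2"
          using M[OF that] pyth[of m l x] pyth[of l m x] by (cases "m \<le> l") (simp_all add: norm_minus_commute)
      qed (use e in simp)
      then show "\<exists>M. \<forall>m\<ge>M. \<forall>n\<ge>M. norm (b m x - b n x) < e" by blast
    qed
    then show ?thesis by (simp add: Cauchy_convergent_iff)
  qed
  then obtain B where B: "\<And>x. (\<lambda>m. b m x) \<longlonglongrightarrow> B x" unfolding convergent_def by metis
  have Bc: "norm (B x) \<le> c * norm x" for x
    using LIMSEQ_le_const2[OF tendsto_norm[OF B]] le by blast
  have "B (x + y) = B x + B y" for x y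
    using LIMSEQ_unique[OF B[of "x + y"]] tendsto_add[OF B[of x] B[of y]]
    by (simp add: bounded_opsD(2)[OF ops])
  moreover have "B (a *\<^sub>C x) = a *\<^sub>C B x" for a x
    using LIMSEQ_unique[OF B[of "a *\<^sub>C x"]] tendsto_scaleC[OF B[of x], of a]
    by (simp add: bounded_opsD(3)[OF ops])
  ultimately have Bops: "B \<in> bounded_ops UNIV UNIV" unfolding bounded_ops_def using Bc by blast
  have perp: "B x - A x \<in> H\<^sup>\<bottom>" for x
  proof (rule closed_sequentially[OF closed_orthogonal_comp])
    show "b m x - A x \<in> H\<^sup>\<bottom>" for m using diff[of 0 m x] b(1) by simp
    show "(\<lambda>m. b m x - A x) \<longlonglongrightarrow> B x - A x" by (intro tendsto_intros B)
  qed
  \<comment> \<open>The relation between consecutive terms shifts the index by one, and both sides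
    have the limits of the unshifted sequence.\<close>
  have "V i (B (C i g)) = B (Q i g)" if "i \<in> I" "g \<in> G i" for i g
  proof (rule LIMSEQ_unique)
    have "(\<lambda>m. V i (b m (C i g))) \<longlonglongrightarrow> V i (B (C i g))"
      using bounded_linear.tendsto[OF bounded_ops_UNIV_imp_bounded_linear[OF V_ops[OF that(1)]] B] .
    then show "(\<lambda>m. b (Suc m) (Q i g)) \<longlonglongrightarrow> V i (B (C i g))" by (simp add: b(4)[OF that])
    show "(\<lambda>m. b (Suc m) (Q i g)) \<longlonglongrightarrow> B (Q i g)" using B by (rule LIMSEQ_Suc)
  qed
  with Bops Bc perp show thesis by (rule that)
qed

end

section \<open>Relaxed commutant lifting\<close>

theorem theorem2p2:
  fixes n :: enat
    and H :: "'k::chilbert_space set"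
    and G :: "nat \<Rightarrow> 'g::chilbert_space set"
    and T V :: "nat \<Rightarrow> 'k \<Rightarrow> 'k"
    and Q C :: "nat \<Rightarrow> 'g \<Rightarrow> 'x::chilbert_space"
    and A :: "'x \<Rightarrow> 'k"
  assumes "1 \<le> n"
    and "closed_csubspace H"
    and "row_contraction n H T"
    and "isometric_lifting n H T V"
    and "\<And>i. i \<in> index_set n \<Longrightarrow> closed_csubspace (G i)"
    and "\<And>i. i \<in> index_set n \<Longrightarrow> Q i \<in> bounded_ops (G i) UNIV"
    and "\<And>i j x y. i \<in> index_set n \<Longrightarrow> j \<in> index_set n \<Longrightarrow> i \<noteq> j \<Longrightarrow>
           x \<in> G i \<Longrightarrow> y \<in> G j \<Longrightarrow> cinner (Q i x) (Q j y) = 0"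
    and "\<And>i. i \<in> index_set n \<Longrightarrow> C i \<in> bounded_ops (G i) UNIV"
    and "\<And>i. i \<in> index_set n \<Longrightarrow>
           op_le_on (G i) (\<lambda>x. adj_on (G i) UNIV (C i) (C i x))
                          (\<lambda>x. adj_on (G i) UNIV (Q i) (Q i x))"
    and "A \<in> bounded_ops UNIV H"
    and "\<And>i x. i \<in> index_set n \<Longrightarrow> x \<in> G i \<Longrightarrow> T i (A (C i x)) = A (Q i x)"
  shows "\<exists>B \<in> bounded_ops UNIV UNIV.
           (\<forall>x. orth_proj H (B x) = A x) \<and>
           onorm B = onorm A \<and>
           (\<forall>i\<in>index_set n. \<forall>x\<in>G i. V i (B (C i x)) = B (Q i x))"
proof -
  note H = assms(2)
  have V: "V i \<in> bounded_ops UNIV UNIV" if "i \<in> index_set n" for i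
    using assms(4) that unfolding isometric_lifting_def by blast
  have proj_V: "orth_proj H (V i x) = T i (orth_proj H x)" if "i \<in> index_set n" for i x
    using assms(4) that unfolding isometric_lifting_def by blast
  have V_adj: "cinner (V i x) y = cinner x (adj_on UNIV UNIV (V i) y)" if "i \<in> index_set n" for i x y
    by (rule cinner_adj_on[OF closed_csubspace_UNIV V[OF that] UNIV_I])
  have V_V: "cinner (V i x) (V j y) = cinner x (if i = j then y else 0)"
    if "i \<in> index_set n" "j \<in> index_set n" for i j x y
    using assms(4) that unfolding V_adj[OF that(1)] isometric_lifting_def by simp
  have perp_iff: "y \<in> H\<^sup>\<bottom> \<longleftrightarrow> (\<forall>z\<in>H. inner y z = 0)" for y
    by (simp add: orthogonal_comp_def orthogonal_def inner_commute)
  have proj_minus: "x - orth_proj H x \<in> H\<^sup>\<bottom>" for x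
    using orth_proj_orthogonal[OF H] by (simp add: perp_iff)
  have A_range: "A x \<in> H" for x using bounded_opsD(1)[OF assms(10)] by simp
  have proj_A: "orth_proj H (A x) = A x" for x using A_range by (intro orth_proj_eqI[OF H]) auto
  have A_linear: "bounded_linear A" by (rule bounded_ops_UNIV_imp_bounded_linear[OF assms(10)])
  interpret lifting_problem "index_set n" H G V Q C "onorm A"
  proof
    show "0 \<le> onorm A" by (rule onorm_pos_le[OF A_linear])
    show "V i \<in> bounded_ops UNIV UNIV" if "i \<in> index_set n" for i by (rule V[OF that])
    show "inner (V i x) (V i y) = inner x y" if "i \<in> index_set n" for i x y
      by (simp add: inner_eq_Re_cinner V_V that)
    show "inner (V i x) (V j y) = 0" if "i \<in> index_set n" "j \<in> index_set n" "i \<noteq> j" for i j x y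
      using cinner_add_right[of x 0 0] by (simp add: inner_eq_Re_cinner V_V that)
    show "\<exists>w. \<forall>x. inner (V i x) y = inner x w" if "i \<in> index_set n" for i y
      using V_adj[OF that] by (auto simp: inner_eq_Re_cinner)
    \<comment> \<open>The projection of \<open>V i y\<close> onto \<open>H\<close> is
      \<open>T i\<close> applied to the projection of \<open>y\<close>, that is,
      \<open>T i 0 = 0\<close>.\<close>
    show "V i y \<in> H\<^sup>\<bottom>" if i: "i \<in> index_set n" and y: "y \<in> H\<^sup>\<bottom>" for i y
    proof -
      have "orth_proj H y = 0"
        using y by (intro orth_proj_eqI[OF H]) (auto simp: perp_iff closed_csubspaceD(1)[OF H])
      moreover have "T i \<in> bounded_ops H H"
        using assms(3) i unfolding row_contraction_def by blast
      ultimately have "orth_proj H (V i y) = 0"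
        using bounded_ops_zero[OF H] by (simp add: proj_V[OF i])
      then show ?thesis using proj_minus[of "V i y"] by simp
    qed
    show "closed_csubspace (G i)" if "i \<in> index_set n" for i by (rule assms(5)[OF that])
    show "Q i \<in> bounded_ops (G i) UNIV" if "i \<in> index_set n" for i by (rule assms(6)[OF that])
    show "C i \<in> bounded_ops (G i) UNIV" if "i \<in> index_set n" for i by (rule assms(8)[OF that])
    show "inner (Q i g) (Q j g') = 0"
      if "i \<in> index_set n" "j \<in> index_set n" "i \<noteq> j" "g \<in> G i" "g' \<in> G j" for i j g g'
      using assms(7)[OF that] by (simp add: inner_eq_Re_cinner)
    show "norm (C i g) \<le> norm (Q i g)" if "i \<in> index_set n" "g \<in> G i" for i g
      using op_le_on_adj_imp_norm_le[OF assms(5,8,6,9)] that by blast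
  qed
  have "partial_lift 0 A" unfolding partial_lift_def
  proof (intro conjI allI ballI)
    show "A \<in> bounded_ops UNIV UNIV" using assms(10) by (auto simp: bounded_ops_def)
    show "norm (A x) \<le> onorm A * norm x" for x by (rule onorm[OF A_linear])
    show "A x \<in> (stage 0)\<^sup>\<bottom>\<^sup>\<bottom>" for x using A_range orthogonal_comp_subset by auto
    \<comment> \<open>The lifting property and the hypothesis on \<open>A\<close> identify
      \<open>A (Q i g)\<close> as the projection of \<open>V i (A (C i g))\<close> onto
      \<open>H\<close>.\<close>
    show "V i (A (C i g)) - A (Q i g) \<in> (stage 0)\<^sup>\<bottom>" if "i \<in> index_set n" "g \<in> G i" for i g
      using proj_minus[of "V i (A (C i g))"] by (simp add: proj_V proj_A assms(11) that)
  qed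
  then obtain B where B: "B \<in> bounded_ops UNIV UNIV" and Bc: "\<And>x. norm (B x) \<le> onorm A * norm x"
    and perp: "\<And>x. B x - A x \<in> H\<^sup>\<bottom>"
    and intertwines: "\<And>i g. i \<in> index_set n \<Longrightarrow> g \<in> G i \<Longrightarrow> V i (B (C i g)) = B (Q i g)"
    by (rule lift_exists) (blast intro: that)
  have proj_B: "orth_proj H (B x) = A x" for x
    using perp[of x] A_range by (intro orth_proj_eqI[OF H]) (auto simp: perp_iff)
  have B_linear: "bounded_linear B" by (rule bounded_ops_UNIV_imp_bounded_linear[OF B])
  \<comment> \<open>Compression cannot increase norms; this gives the lower bound for
    \<open>onorm B\<close>, the upper one being the choice \<open>c = onorm A\<close>.\<close>
  have "norm (A x) \<le> norm (B x)" for x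
  proof (rule power2_le_imp_le)
    have "(norm (B x))\<^sup>2 = (norm (A x))\<^sup>2 + (norm (B x - A x))\<^sup>2"
      using norm_add_orthogonal_comp[OF perp A_range, of x x] by simp
    then show "(norm (A x))\<^sup>2 \<le> (norm (B x))\<^sup>2" by simp
  qed simp
  then have "onorm A \<le> onorm B"
    by (intro onorm_bound onorm_pos_le[OF B_linear]) (meson onorm[OF B_linear] order_trans)
  moreover have "onorm B \<le> onorm A" by (intro onorm_bound onorm_pos_le[OF A_linear] Bc)
  ultimately show ?thesis using B proj_B intertwines by auto
qed

end
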